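(* Let $\mathbb K$ be a field of characteristic zero and let $\mathfrak B$ be an $n$-dimensional Abelian Lie subalgebra of $\mathfrak{gl}(n,\mathbb K)$. Write $\mathfrak B=\mathbb K\,\mathbb I_{\mathbb K^n}\oplus L$, where $\mathbb I_{\mathbb K^n}$ is the identity matrix and $L$ is an $(n-1)$-dimensional Abelian subalgebra of $\mathfrak{sl}(n,\mathbb K)$. Suppose that the contragredient action $\rho^*:\mathfrak B\times(\mathbb K^n)^*\to(\mathbb K^n)^*$, $(a,f)\mapsto\rho^*(a)f:=-f\circ a$, has an open orbit. Then $\mathfrak B$ is a maximal Abelian subalgebra of $\mathfrak{gl}(n,\mathbb K)$ and $L$ is a maximal Abelian subalgebra of $\mathfrak{sl}(n,\mathbb K)$.
   Context: The action $\rho^*$ has an open orbit if there is $\alpha\in(\mathbb K^n)^*$ such that $\{\rho^*(a)\alpha: a\in\mathfrak B\}=(\mathbb K^n)^*$. A maximal Abelian subalgebra (MASA) of a Lie algebra $\mathcal G$ is an Abelian subalgebra contained in no bigger Abelian subalgebra of $\mathcal G$; equivalently, one that coincides with its centralizer in $\mathcal G$. *)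

theory Defs
  imports "HOL-Analysis.Analysis"
begin

text \<open>Scalar multiplication over the entry field: the library's \<open>(*s)\<close> would need a row vector as
  the scalar of a matrix, and \<open>(*\<^sub>R)\<close> covers only real scalars.\<close>

definition mscale :: "'a::field \<Rightarrow> 'a^'n^'m \<Rightarrow> 'a^'n^'m"
  where "mscale c A = (\<chi> i j. c * A $ i $ j)"

global_interpretation matrices: vector_space mscale
  by unfold_locales (simp_all add: mscale_def vec_eq_iff algebra_simps)

definition lie_bracket :: "'a::field^'n^'n \<Rightarrow> 'a^'n^'n \<Rightarrow> 'a^'n^'n"
  where "lie_bracket A B = A ** B - B ** A"

definition gl :: "('a::field^'n^'n) set"
  where "gl = UNIV"

definition sl :: "('a::field^'n^'n) set"
  where "sl = {A. trace A = 0}"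

definition lie_subalgebra :: "('a::field^'n^'n) set \<Rightarrow> ('a^'n^'n) set \<Rightarrow> bool"
  where "lie_subalgebra G H \<longleftrightarrow>
    H \<subseteq> G \<and> matrices.subspace H \<and> (\<forall>A\<in>H. \<forall>B\<in>H. lie_bracket A B \<in> H)"

definition abelian_subalgebra :: "('a::field^'n^'n) set \<Rightarrow> ('a^'n^'n) set \<Rightarrow> bool"
  where "abelian_subalgebra G H \<longleftrightarrow>
    lie_subalgebra G H \<and> (\<forall>A\<in>H. \<forall>B\<in>H. lie_bracket A B = 0)"

definition masa :: "('a::field^'n^'n) set \<Rightarrow> ('a^'n^'n) set \<Rightarrow> bool"
  where "masa G H \<longleftrightarrow>
    abelian_subalgebra G H \<and> \<not> (\<exists>H'. abelian_subalgebra G H' \<and> H \<subset> H')"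

definition internal_direct_sum ::
    "('a::field^'n^'n) set \<Rightarrow> ('a^'n^'n) set \<Rightarrow> ('a^'n^'n) set \<Rightarrow> bool"
  where "internal_direct_sum V U W \<longleftrightarrow>
    matrices.subspace U \<and> matrices.subspace W \<and>
    V = {u + w | u w. u \<in> U \<and> w \<in> W} \<and> U \<inter> W = {0}"

definition dual_space :: "('a::field^'n \<Rightarrow> 'a) set"
  where "dual_space = {f. Vector_Spaces.linear (*s) (*) f}"

definition contragredient :: "'a::field^'n^'n \<Rightarrow> ('a^'n \<Rightarrow> 'a) \<Rightarrow> ('a^'n \<Rightarrow> 'a)"
  where "contragredient A f = (\<lambda>x. - f (A *v x))"

text \<open>Openness is not topological here: an open orbit is one that fills the whole dual space.\<close>

definition has_open_orbit :: "('a::field^'n^'n) set \<Rightarrow> bool"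
  where "has_open_orbit B \<longleftrightarrow>
    (\<exists>\<alpha>\<in>dual_space. {contragredient A \<alpha> | A. A \<in> B} = dual_space)"

end

theory Submission
  imports Defs
begin

text \<open>Every dual vector has the form \<open>- \<alpha> \<circ> A\<close> with \<open>A \<in> B\<close>, for the \<open>\<alpha>\<close> spanning the open orbit.
  So a matrix \<open>C\<close> commuting with \<open>B\<close> and satisfying \<open>\<alpha> \<circ> C = 0\<close> is annihilated by every dual
  vector, since \<open>\<alpha> \<circ> A \<circ> C = \<alpha> \<circ> C \<circ> A = 0\<close>, and hence vanishes. For any \<open>X\<close> in the
  centralizer of \<open>B\<close>, surjectivity gives \<open>A \<in> B\<close> with \<open>\<alpha> \<circ> X = \<alpha> \<circ> A\<close>; then \<open>C = X - A\<close> is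
  such a matrix, and \<open>X = A \<in> B\<close>. A traceless matrix commuting with \<open>L\<close> commutes with \<open>B\<close>, hence
  lies in \<open>B\<close>, and its scalar component vanishes by taking traces.\<close>

lemma linear_functional_comp_matrix:
  assumes "f \<in> dual_space"
  shows "(\<lambda>x. - f (A *v x)) \<in> dual_space"
proof -
  interpret f: Vector_Spaces.linear "(*s)" "(*)" f
    using assms by (simp add: dual_space_def)
  show ?thesis
    unfolding dual_space_def mem_Collect_eq
    by unfold_locales
      (simp_all add: f.add f.scale matrix_vector_right_distrib vector_scalar_commute algebra_simps)
qed

lemma coordinate_in_dual_space: "(\<lambda>x::'a::field^'n. x $ i) \<in> dual_space"
  unfolding dual_space_def mem_Collect_eq
  by unfold_locales (simp_all add: algebra_simps)

text \<open>The coordinate functionals already separate vectors, so every \<open>C *v x\<close>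
  vanishes.\<close>

lemma matrix_eq_zero_if_dual_annihilates:
  fixes C :: "'a::field^'n^'n"
  assumes "\<And>f x. f \<in> dual_space \<Longrightarrow> f (C *v x) = 0"
  shows "C = 0"
proof -
  have "C *v x = 0 *v x" for x
    using assms[OF coordinate_in_dual_space] by (simp add: vec_eq_iff)
  then show ?thesis
    by (simp add: matrix_eq)
qed

lemma lie_bracket_add_right: "lie_bracket X (A + A') = lie_bracket X A + lie_bracket X A'"
  by (simp add: lie_bracket_def matrix_matrix_mult_def vec_eq_iff algebra_simps sum.distrib)

lemma lie_bracket_diff_left: "lie_bracket (X - Y) A = lie_bracket X A - lie_bracket Y A"
  by (simp add: lie_bracket_def matrix_matrix_mult_def vec_eq_iff algebra_simps sum_subtractf)

text \<open>Serves both maximality claims: an element of a larger Abelian subalgebra centralizes the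
  smaller one.\<close>

lemma centralizer_in_open_orbit_algebra:
  fixes B :: "('a::field^'n^'n) set"
  assumes orbit: "has_open_orbit B"
    and comm_B: "\<And>A A'. A \<in> B \<Longrightarrow> A' \<in> B \<Longrightarrow> lie_bracket A A' = 0"
    and comm_X: "\<And>A. A \<in> B \<Longrightarrow> lie_bracket X A = 0"
  shows "X \<in> B"
proof -
  obtain \<alpha> where \<alpha>: "\<alpha> \<in> dual_space"
    and orb: "{contragredient A \<alpha> | A. A \<in> B} = dual_space"
    using orbit by (auto simp: has_open_orbit_def)
  interpret \<alpha>: Vector_Spaces.linear "(*s)" "(*)" \<alpha>
    using \<alpha> by (simp add: dual_space_def)
  have "contragredient X \<alpha> \<in> dual_space"
    unfolding contragredient_def by (rule linear_functional_comp_matrix[OF \<alpha>])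
  then obtain A where A: "A \<in> B" and eq: "contragredient X \<alpha> = contragredient A \<alpha>"
    using orb by blast
  have \<alpha>C: "\<alpha> ((X - A) *v x) = 0" for x
    using fun_cong[OF eq, of x]
    by (simp add: contragredient_def matrix_vector_mult_diff_rdistrib \<alpha>.diff)
  have "X - A = 0"
  proof (rule matrix_eq_zero_if_dual_annihilates)
    fix f :: "'a^'n \<Rightarrow> 'a" and x
    assume "f \<in> dual_space"
    then obtain A' where A': "A' \<in> B" and f: "f = contragredient A' \<alpha>"
      using orb by blast
    \<comment> \<open>\<open>A'\<close> commutes with both \<open>X\<close> and \<open>A\<close>.
      Swapping the factors puts \<open>X - A\<close> directly under \<alpha>, which vanishes on its
      range.\<close>
    have "A' ** (X - A) = (X - A) ** A'"
      using lie_bracket_diff_left[of X A A'] comm_X[OF A'] comm_B[OF A A']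
      by (simp add: lie_bracket_def)
    then have "f ((X - A) *v x) = - \<alpha> ((X - A) *v (A' *v x))"
      by (simp add: f contragredient_def matrix_vector_mul_assoc)
    then show "f ((X - A) *v x) = 0"
      by (simp add: \<alpha>C)
  qed
  then show ?thesis
    using A by simp
qed

lemma lie_bracket_scalar_right: "lie_bracket X (mscale c (mat 1)) = 0"
  by (simp add: lie_bracket_def mscale_def mat_def matrix_matrix_mult_def vec_eq_iff
      if_distrib if_distribR sum.delta sum.delta' mult.commute cong: if_cong)

lemma trace_scalar: "trace (mscale c (mat 1) :: 'a::field^'n^'n) = of_nat CARD('n) * c"
  by (simp add: trace_def mscale_def mat_def)

theorem theorem6p1:
  fixes B L :: "('a::field_char_0^'n^'n) set"
  assumes "abelian_subalgebra gl B"
    and "matrices.dim B = CARD('n)"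
    and "abelian_subalgebra sl L"
    and "matrices.dim L = CARD('n) - 1"
    and "internal_direct_sum B (matrices.span {mat 1}) L"
    and "has_open_orbit B"
  shows "masa gl B \<and> masa sl L"
proof
  have comm_B: "lie_bracket A A' = 0" if "A \<in> B" "A' \<in> B" for A A'
    using assms(1) that by (simp add: abelian_subalgebra_def)
  note centralizer = centralizer_in_open_orbit_algebra[OF assms(6) comm_B]
  have decomp: "\<exists>c l. l \<in> L \<and> A = mscale c (mat 1) + l" if "A \<in> B" for A
    using assms(5) that by (auto simp: internal_direct_sum_def matrices.span_singleton)
  show "masa gl B"
    unfolding masa_def
  proof (intro conjI notI assms(1))
    assume "\<exists>H'. abelian_subalgebra gl H' \<and> B \<subset> H'"
    then obtain H X where H: "abelian_subalgebra gl H" "B \<subset> H" and X: "X \<in> H" "X \<notin> B"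
      by blast
    have "lie_bracket X A = 0" if "A \<in> B" for A
      using H X(1) that by (auto simp: abelian_subalgebra_def)
    with X(2) show False
      using centralizer by blast
  qed
  show "masa sl L"
    unfolding masa_def
  proof (intro conjI notI assms(3))
    assume "\<exists>H'. abelian_subalgebra sl H' \<and> L \<subset> H'"
    then obtain H X where H: "abelian_subalgebra sl H" "L \<subset> H" and X: "X \<in> H" "X \<notin> L"
      by blast
    have "lie_bracket X l = 0" if "l \<in> L" for l
      using H X(1) that by (auto simp: abelian_subalgebra_def)
    \<comment> \<open>Scalar matrices are central, so commuting with \<open>L\<close> extends to all
      of \<open>B\<close>.\<close>
    then have "lie_bracket X A = 0" if "A \<in> B" for A
      using decomp[OF that] by (auto simp: lie_bracket_add_right lie_bracket_scalar_right)
    then have "X \<in> B"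
      using centralizer by blast
    then obtain c l where l: "l \<in> L" and Xeq: "X = mscale c (mat 1) + l"
      using decomp by blast
    have "trace X = 0" "trace l = 0"
      using H(1) X(1) l assms(3) by (auto simp: abelian_subalgebra_def lie_subalgebra_def sl_def)
    \<comment> \<open>Taking traces leaves \<open>of_nat CARD('n) * c = 0\<close>, and in
      characteristic zero the first factor is nonzero.\<close>
    then have "c = 0"
      by (simp add: Xeq trace_add trace_scalar)
    with Xeq X(2) l show False
      by simp
  qed
qed

end
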